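(* Let $N\ge3$ be an integer, $m>0$, $\sigma>-2$ and $p=p_s(\sigma)=\frac{m(N+2\sigma+2)}{N-2}$. Then for any $C>0$ the function $$U_C(x)=\left[\frac{(N-2)(N+\sigma)C}{(|x|^{\sigma+2}+C)^2}\right]^{(N-2)/(2m(\sigma+2))}$$ is a stationary solution to $u_t=\Delta u^m+|x|^{\sigma}u^p$, that is, $\Delta U_C^m+|x|^{\sigma}U_C^p=0$ (pointwise for $x\neq0$). If moreover $0<m<1$ and $\sigma>0$, then, regarding $U_C$ as a function of $r=|x|$, one has $U_C(0)\in(0,\infty)$, $U_C'(0)=0$, and $U_C(r)\sim K r^{-(N-2)/m}$ as $r\to\infty$ for some constant $K>0$.
   Context: $f\sim g$ as $r\to\infty$ means $f/g\to1$. *)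

theory Defs
  imports "HOL-Analysis.Analysis" "HOL-Library.Landau_Symbols"
begin

definition partial_derivative :: "'n \<Rightarrow> (real ^ 'n \<Rightarrow> real) \<Rightarrow> real ^ 'n::finite \<Rightarrow> real" where
  "partial_derivative i f x = frechet_derivative f (at x) (axis i 1)"

definition laplacian :: "(real ^ 'n \<Rightarrow> real) \<Rightarrow> real ^ 'n::finite \<Rightarrow> real" where
  "laplacian f x = (\<Sum>i\<in>UNIV. partial_derivative i (partial_derivative i f) x)"

text \<open>\<^const>\<open>frechet_derivative\<close> is an arbitrary value where no derivative exists, so
  \<^const>\<open>laplacian\<close> is meaningful only under the following condition.\<close>

definition twice_differentiable_at :: "(real ^ 'n \<Rightarrow> real) \<Rightarrow> real ^ 'n::finite \<Rightarrow> bool" where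
  "twice_differentiable_at f x \<longleftrightarrow>
     (\<forall>\<^sub>F y in nhds x. f differentiable (at y)) \<and>
     (\<forall>i. partial_derivative i f differentiable (at x))"

text \<open>Pointwise validity at \<open>(t, x)\<close> of \<open>u\<^sub>t = \<Delta>u\<^sup>m + |x|\<^sup>\<sigma> u\<^sup>p\<close>.\<close>

definition satisfies_pde_at ::
  "real \<Rightarrow> real \<Rightarrow> real \<Rightarrow> (real \<Rightarrow> real ^ 'n \<Rightarrow> real) \<Rightarrow> real \<Rightarrow> real ^ 'n::finite \<Rightarrow> bool" where
  "satisfies_pde_at m \<sigma> p u t x \<longleftrightarrow>
     twice_differentiable_at (\<lambda>y. u t y powr m) x \<and>
     ((\<lambda>s. u s x) has_real_derivative
        laplacian (\<lambda>y. u t y powr m) x + norm x powr \<sigma> * u t x powr p) (at t)"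

text \<open>The point \<open>x = 0\<close> is excluded: there the weight is singular for \<open>\<sigma> < 0\<close>.\<close>

definition stationary_solution ::
  "real \<Rightarrow> real \<Rightarrow> real \<Rightarrow> (real ^ 'n::finite \<Rightarrow> real) \<Rightarrow> bool" where
  "stationary_solution m \<sigma> p U \<longleftrightarrow> (\<forall>t x. x \<noteq> 0 \<longrightarrow> satisfies_pde_at m \<sigma> p (\<lambda>_. U) t x)"

definition p_s :: "nat \<Rightarrow> real \<Rightarrow> real \<Rightarrow> real" where
  "p_s N m \<sigma> = m * (real N + 2 * \<sigma> + 2) / (real N - 2)"

definition U_profile :: "nat \<Rightarrow> real \<Rightarrow> real \<Rightarrow> real \<Rightarrow> real \<Rightarrow> real" where
  "U_profile N m \<sigma> C r =
     ((real N - 2) * (real N + \<sigma>) * C / (r powr (\<sigma> + 2) + C)\<^sup>2)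
       powr ((real N - 2) / (2 * m * (\<sigma> + 2)))"

definition U_C :: "real \<Rightarrow> real \<Rightarrow> real \<Rightarrow> real ^ 'n::finite \<Rightarrow> real" where
  "U_C m \<sigma> C x = U_profile CARD('n) m \<sigma> C (norm x)"

end

theory Submission
  imports Defs "HOL-Real_Asymp.Real_Asymp"
begin

text \<open>With \<open>q = |x|\<^sup>2\<close>, the function \<open>U\<^sub>C\<^sup>m\<close> is a constant multiple of \<open>g q = (q\<^sup>a + C)\<^sup>b\<close>, where
  \<open>a = (\<sigma> + 2)/2\<close> and \<open>b = -(N - 2)/(\<sigma> + 2)\<close>, and the Laplacian of \<open>g (|x|\<^sup>2)\<close> is \<open>4 q g'' q + 2 N g' q\<close>.
  Because \<open>2 a b = -(N - 2)\<close>, the terms in \<open>q\<^sup>a\<close> cancel in the latter, leaving a multiple of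
  \<open>q powr (a - 1) * (q\<^sup>a + C) powr (b - 2)\<close>; the exponent \<open>p\<^sub>s(\<sigma>)\<close> is the one for which
  \<open>|x|\<^sup>\<sigma> U\<^sub>C\<^sup>p\<close> has this form as well.\<close>

section \<open>Calculus of radial functions written in the variable
  \<open>x \<bullet> x\<close>\<close>

lemma radial_has_derivative:
  fixes x :: "'a::real_inner"
  assumes "(g has_real_derivative d) (at (x \<bullet> x))"
  shows "((\<lambda>y. g (y \<bullet> y)) has_derivative (\<lambda>h. 2 * d * (x \<bullet> h))) (at x)"
proof -
  have "((\<lambda>y. y \<bullet> y) has_derivative (\<lambda>h. 2 * (x \<bullet> h))) (at x)"
    by (auto intro!: derivative_eq_intros simp: inner_commute)
  from has_derivative_compose[OF this, of g "(*) d"] show ?thesis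
    using assms by (simp add: has_field_derivative_def mult_ac)
qed

lemma partial_derivative_eq:
  assumes "(f has_derivative f') (at x)"
  shows "partial_derivative i f x = f' (axis i 1)"
  using frechet_derivative_at[OF assms] by (simp add: partial_derivative_def)

lemma partial_derivative_radial:
  fixes x :: "real ^ 'n::finite"
  assumes "(g has_real_derivative d) (at (x \<bullet> x))"
  shows "partial_derivative i (\<lambda>y. g (y \<bullet> y)) x = 2 * d * x $ i"
  by (simp add: partial_derivative_eq[OF radial_has_derivative[OF assms]] inner_axis)

text \<open>Away from the origin the first partial derivative is a radial factor times a coordinate,
  so the product rule gives its derivative. The formula for it is known only where
  \<open>y \<bullet> y > 0\<close>; as that set is open, it may be differentiated at
  \<open>x\<close>.\<close>

lemma partial_derivative_radial_has_derivative:
  fixes x :: "real ^ 'n::finite"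
  assumes g: "\<And>q. q > 0 \<Longrightarrow> (g has_real_derivative g' q) (at q)"
    and g': "(g' has_real_derivative d) (at (x \<bullet> x))"
    and "x \<noteq> 0"
  shows "(partial_derivative i (\<lambda>y. g (y \<bullet> y)) has_derivative
           (\<lambda>h. 2 * (2 * d * (x \<bullet> h)) * x $ i + 2 * g' (x \<bullet> x) * h $ i)) (at x)"
proof -
  have "((\<lambda>y. 2 * g' (y \<bullet> y) * y $ i) has_derivative
           (\<lambda>h. 2 * (2 * d * (x \<bullet> h)) * x $ i + 2 * g' (x \<bullet> x) * h $ i)) (at x)"
    by (rule derivative_eq_intros radial_has_derivative[OF g']
         bounded_linear_imp_has_derivative bounded_linear_vec_nth refl | simp add: algebra_simps)+
  then show ?thesis
  proof (rule has_derivative_transform_within_open)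
    show "open (- {0 :: real ^ 'n})" "x \<in> - {0}" using \<open>x \<noteq> 0\<close> by auto
    show "2 * g' (y \<bullet> y) * y $ i = partial_derivative i (\<lambda>y. g (y \<bullet> y)) y" if "y \<in> - {0}" for y
      using that by (subst partial_derivative_radial[OF g]) auto
  qed
qed

lemma twice_differentiable_at_radial:
  fixes x :: "real ^ 'n::finite"
  assumes g: "\<And>q. q > 0 \<Longrightarrow> (g has_real_derivative g' q) (at q)"
    and g': "(g' has_real_derivative d) (at (x \<bullet> x))"
    and "x \<noteq> 0"
  shows "twice_differentiable_at (\<lambda>y. g (y \<bullet> y)) x"
  unfolding twice_differentiable_at_def
proof (intro conjI allI)
  have "\<forall>\<^sub>F y in nhds x. y \<in> - {0}"
    using \<open>x \<noteq> 0\<close> by (intro eventually_nhds_in_open) auto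
  then show "\<forall>\<^sub>F y in nhds x. (\<lambda>y. g (y \<bullet> y)) differentiable (at y)"
  proof eventually_elim
    case (elim y)
    then have "y \<bullet> y > 0" by simp
    from radial_has_derivative[OF g[OF this]] show ?case by (rule differentiableI)
  qed
  show "partial_derivative i (\<lambda>y. g (y \<bullet> y)) differentiable (at x)" for i
    using partial_derivative_radial_has_derivative[OF assms] by (rule differentiableI)
qed

text \<open>The \<open>i\<close>-th second partial derivative is
  \<open>4 * d * (x $ i)\<^sup>2 + 2 * g' (x \<bullet> x)\<close>. Summation turns the squares into
  \<open>x \<bullet> x\<close> and counts the last term once per dimension.\<close>

lemma laplacian_radial:
  fixes x :: "real ^ 'n::finite"
  assumes g: "\<And>q. q > 0 \<Longrightarrow> (g has_real_derivative g' q) (at q)"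
    and g': "(g' has_real_derivative d) (at (x \<bullet> x))"
    and "x \<noteq> 0"
  shows "laplacian (\<lambda>y. g (y \<bullet> y)) x =
           4 * (x \<bullet> x) * d + 2 * real CARD('n) * g' (x \<bullet> x)"
proof -
  have "laplacian (\<lambda>y. g (y \<bullet> y)) x = (\<Sum>i\<in>UNIV. 4 * d * (x $ i * x $ i) + 2 * g' (x \<bullet> x))"
    unfolding laplacian_def
    by (rule sum.cong[OF refl],
        subst partial_derivative_eq[OF partial_derivative_radial_has_derivative[OF assms]])
       (simp_all add: inner_axis axis_nth mult_ac)
  also have "\<dots> = 4 * d * (x \<bullet> x) + 2 * real CARD('n) * g' (x \<bullet> x)"
    by (simp add: sum.distrib inner_vec_def flip: sum_distrib_left)
  finally show ?thesis by (simp add: mult_ac)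
qed

section \<open>Derivatives of \<open>(q powr a + C) powr b\<close>\<close>

lemma powr_plus_const_has_derivative:
  fixes a b C q :: real
  assumes "q > 0" "C > 0"
  shows "((\<lambda>q. (q powr a + C) powr b) has_real_derivative
           b * a * q powr (a - 1) * (q powr a + C) powr (b - 1)) (at q)"
proof -
  have "q powr a + C > 0" using assms by (simp add: add_nonneg_pos)
  with assms show ?thesis
    by (auto intro!: derivative_eq_intros simp: powr_diff field_simps)
qed

text \<open>The common factor \<open>(q powr a + C) powr (b - 2)\<close> is pulled out so that the
  remaining bracket is linear in \<open>q powr a\<close> and \<open>C\<close>; the cancellation in
  the Laplacian takes place there.\<close>

lemma powr_plus_const_has_second_derivative:
  fixes a b C q :: real
  assumes "q > 0" "C > 0"
  shows "((\<lambda>q. b * a * q powr (a - 1) * (q powr a + C) powr (b - 1)) has_real_derivative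
           b * a * q powr (a - 1) / q * (q powr a + C) powr (b - 2) *
             ((a - 1) * (q powr a + C) + (b - 1) * a * q powr a)) (at q)"
proof -
  have D: "q powr a + C > 0" using assms by (simp add: add_nonneg_pos)
  have d1: "((\<lambda>q. q powr (a - 1)) has_real_derivative (a - 1) * q powr (a - 1) / q) (at q)"
    using has_real_derivative_powr[OF assms(1), of "a - 1"] assms
    by (simp add: powr_diff power2_eq_square)
  have e: "(q powr a + C) powr (b - 1) = (q powr a + C) powr (b - 2) * (q powr a + C)"
    using D powr_add[of "q powr a + C" "b - 2" 1] by simp
  have f: "q powr (a - 1) = q powr a / q"
    using assms by (simp add: powr_diff)
  show ?thesis
    by (rule DERIV_cong[OF DERIV_mult[OF DERIV_mult[OF DERIV_const d1]
          powr_plus_const_has_derivative[OF assms, of a "b - 1"]]])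
       (unfold e f, use assms in \<open>simp add: field_simps\<close>)
qed

section \<open>The profile as a constant times a power of
  \<open>r powr (\<sigma> + 2) + C\<close>\<close>

lemma U_profile_eq:
  assumes "C > 0"
  shows "U_profile N m \<sigma> C r =
           ((real N - 2) * (real N + \<sigma>) * C) powr ((real N - 2) / (2 * m * (\<sigma> + 2)))
             * (r powr (\<sigma> + 2) + C) powr (- ((real N - 2) / (m * (\<sigma> + 2))))"
proof -
  have D: "r powr (\<sigma> + 2) + C > 0" using assms by (simp add: add_nonneg_pos)
  have "((r powr (\<sigma> + 2) + C)\<^sup>2) powr e = (r powr (\<sigma> + 2) + C) powr (2 * e)" for e
    using D by (simp add: powr_powr flip: powr_numeral)
  moreover have "2 * (x / (2 * m * (\<sigma> + 2))) = x / (m * (\<sigma> + 2))" for x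
    by simp
  ultimately have "((r powr (\<sigma> + 2) + C)\<^sup>2) powr ((real N - 2) / (2 * m * (\<sigma> + 2)))
      = (r powr (\<sigma> + 2) + C) powr ((real N - 2) / (m * (\<sigma> + 2)))"
    by metis
  then show ?thesis
    unfolding U_profile_def by (simp add: powr_divide powr_minus_divide)
qed

text \<open>The exponent \<open>k\<close> is left free to serve both terms of the equation:
  \<open>k = m\<close> under the Laplacian and \<open>k = p_s\<close> in the source.\<close>

lemma U_C_powr_eq:
  fixes x :: "real ^ 'n::finite"
  assumes "C > 0"
  shows "U_C m \<sigma> C x powr k =
           ((real CARD('n) - 2) * (real CARD('n) + \<sigma>) * C)
               powr (k * (real CARD('n) - 2) / (2 * m * (\<sigma> + 2)))
             * ((x \<bullet> x) powr ((\<sigma> + 2) / 2) + C)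
               powr (- (k * (real CARD('n) - 2) / (m * (\<sigma> + 2))))"
proof -
  have "norm x powr (\<sigma> + 2) = (x \<bullet> x) powr ((\<sigma> + 2) / 2)"
    by (simp add: norm_eq_sqrt_inner powr_powr flip: powr_half_sqrt)
  then show ?thesis
    unfolding U_C_def U_profile_eq[OF assms] by (simp add: powr_mult powr_powr mult_ac)
qed

section \<open>The elliptic equation away from the origin\<close>

lemma U_C_elliptic:
  fixes x :: "real ^ 'n::finite" and m \<sigma> C :: real
  assumes N: "CARD('n) \<ge> 3" and "m > 0" and \<sigma>: "\<sigma> > -2" and "C > 0" and "x \<noteq> 0"
  shows "twice_differentiable_at (\<lambda>y. U_C m \<sigma> C y powr m) x"
    and "laplacian (\<lambda>y. U_C m \<sigma> C y powr m) x
           + norm x powr \<sigma> * U_C m \<sigma> C x powr p_s CARD('n) m \<sigma> = 0"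
proof -
  define n where "n = real CARD('n)"
  have n: "n \<ge> 3" using N by (simp add: n_def)
  define A where "A = (n - 2) * (n + \<sigma>) * C"
  have A: "A > 0" using n \<sigma> \<open>C > 0\<close> by (simp add: A_def)
  define a where "a = (\<sigma> + 2) / 2"
  have a: "a > 0" using \<sigma> by (simp add: a_def)
  define b where "b = - ((n - 2) / (\<sigma> + 2))"
  have ba: "b * a = - (n - 2) / 2" using \<sigma> by (simp add: a_def b_def field_simps)
  define q where "q = x \<bullet> x"
  have q: "q > 0" using \<open>x \<noteq> 0\<close> by (simp add: q_def)
  define D where "D = q powr a + C"
  define g where "g = (\<lambda>q. (q powr a + C) powr b)"
  define g' where "g' = (\<lambda>q. b * a * q powr (a - 1) * (q powr a + C) powr (b - 1))"
  define g'' where "g'' = b * a * q powr (a - 1) / q * D powr (b - 2) *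
             ((a - 1) * D + (b - 1) * a * q powr a)"
  \<comment> \<open>This is the constant factor of \<open>U_C powr m\<close>: for
    \<open>k = m\<close> the factor \<open>m\<close> drops out of the exponent of \<open>A\<close>,
    leaving \<open>(n - 2) / (2 * (\<sigma> + 2)) = - b / 2\<close>.\<close>
  define K where "K = A powr (- b / 2)"
  have dg: "((\<lambda>q. K * g q) has_real_derivative K * g' q) (at q)" if "q > 0" for q
    unfolding g_def g'_def
    by (rule DERIV_cmult[OF powr_plus_const_has_derivative[OF that \<open>C > 0\<close>]])
  have dg': "((\<lambda>q. K * g' q) has_real_derivative K * g'') (at (x \<bullet> x))"
    unfolding g'_def g''_def D_def q_def[symmetric]
    by (rule DERIV_cmult[OF powr_plus_const_has_second_derivative[OF q \<open>C > 0\<close>]])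
  have U: "(\<lambda>y. U_C m \<sigma> C y powr m) = (\<lambda>y :: real ^ 'n. K * g (y \<bullet> y))"
    unfolding U_C_powr_eq[OF \<open>C > 0\<close>] using \<open>m > 0\<close>
    by (simp add: K_def g_def A_def n_def a_def b_def mult_ac)
  show "twice_differentiable_at (\<lambda>y. U_C m \<sigma> C y powr m) x"
    unfolding U using dg dg' \<open>x \<noteq> 0\<close> by (rule twice_differentiable_at_radial)
  have lap: "laplacian (\<lambda>y. U_C m \<sigma> C y powr m) x = K * (4 * q * g'' + 2 * n * g' q)"
    using laplacian_radial[OF dg dg' \<open>x \<noteq> 0\<close>] unfolding U by (simp add: q_def n_def algebra_simps)
  have D: "D > 0" using \<open>C > 0\<close> by (simp add: D_def add_nonneg_pos)
  have Db: "D powr (b - 1) = D powr (b - 2) * D"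
    using D powr_add[of D "b - 2" 1] by simp
  have "4 * q * g'' + 2 * n * g' q =
      2 * (b * a) * q powr (a - 1) * D powr (b - 2)
        * (2 * ((a - 1) * D + (b * a - a) * q powr a) + n * D)"
    using q by (simp add: g''_def g'_def Db flip: D_def) (simp add: field_simps)
  \<comment> \<open>The coefficient of \<open>q powr a\<close> is \<open>2 * b * a - 2 + n\<close>,
    which vanishes by \<open>ba\<close>; that of \<open>C\<close> is
    \<open>2 * (a - 1) + n = n + \<sigma>\<close>.\<close>
  also have "2 * ((a - 1) * D + (b * a - a) * q powr a) + n * D = (n + \<sigma>) * C"
    unfolding ba D_def by (simp add: a_def field_simps)
  \<comment> \<open>Since \<open>2 * (b * a) = - (n - 2)\<close>, the constants combine to
    \<open>- A\<close>, which explains the numerator chosen in \<open>U_profile\<close>.\<close>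
  also have "2 * (b * a) * q powr (a - 1) * D powr (b - 2) * ((n + \<sigma>) * C)
      = - (A * q powr (a - 1) * D powr (b - 2))"
    unfolding ba by (simp add: A_def field_simps)
  finally have lap': "laplacian (\<lambda>y. U_C m \<sigma> C y powr m) x
      = - (K * A * q powr (a - 1) * D powr (b - 2))"
    unfolding lap by simp
  have w: "norm x powr \<sigma> = q powr (a - 1)"
    by (simp add: norm_eq_sqrt_inner powr_powr a_def q_def field_simps flip: powr_half_sqrt)
  \<comment> \<open>This exponent computation is where the value of \<open>p_s\<close> enters: it
    makes the source carry the same power \<open>D powr (b - 2)\<close> as the Laplacian.\<close>
  have p: "p_s CARD('n) m \<sigma> * (n - 2) / (m * (\<sigma> + 2)) = 2 - b"
  proof -
    have "p_s CARD('n) m \<sigma> * (n - 2) = m * (n + 2 * \<sigma> + 2)"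
      using n by (simp add: p_s_def flip: n_def)
    then have "p_s CARD('n) m \<sigma> * (n - 2) / (m * (\<sigma> + 2)) = (n + 2 * \<sigma> + 2) / (\<sigma> + 2)"
      using \<open>m > 0\<close> by simp
    also have "\<dots> = 2 - b"
      using \<sigma> by (simp add: b_def field_simps)
    finally show ?thesis .
  qed
  have "c / (2 * m * (\<sigma> + 2)) = c / (m * (\<sigma> + 2)) / 2" for c
    by simp
  then have p2: "p_s CARD('n) m \<sigma> * (n - 2) / (2 * m * (\<sigma> + 2)) = - b / 2 + 1"
    by (simp only: p) (simp add: diff_divide_distrib)
  have "U_C m \<sigma> C x powr p_s CARD('n) m \<sigma> = A powr (- b / 2 + 1) * D powr (b - 2)"
    unfolding U_C_powr_eq[OF \<open>C > 0\<close>]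
    unfolding n_def[symmetric] p p2 by (simp add: A_def D_def q_def a_def)
  \<comment> \<open>The exponent of \<open>A\<close> exceeds that in \<open>K\<close> by exactly
    one, which supplies the factor \<open>A\<close> found in the Laplacian.\<close>
  also have "A powr (- b / 2 + 1) = K * A"
    using A unfolding K_def powr_add by simp
  finally show "laplacian (\<lambda>y. U_C m \<sigma> C y powr m) x
           + norm x powr \<sigma> * U_C m \<sigma> C x powr p_s CARD('n) m \<sigma> = 0"
    unfolding lap' w by simp
qed

section \<open>Behaviour of the profile at the origin and at infinity\<close>

lemma powr_has_derivative_0_at_0:
  assumes "s > 1"
  shows "((\<lambda>r::real. r powr s) has_real_derivative 0) (at 0 within {0..})"
proof -
  \<comment> \<open>This is the limit of the difference quotient at 0, as
    \<open>0 powr s = 0\<close>. It is one-sided because \<open>r = |x|\<close> ranges over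
    \<open>{0..}\<close>.\<close>
  have "((\<lambda>r::real. r powr (s - 1)) \<longlongrightarrow> 0) (at_right 0)"
    using assms by real_asymp
  moreover have "\<forall>\<^sub>F r::real in at_right 0. r powr (s - 1) = r powr s / r"
    using eventually_at_right_less[of 0] by eventually_elim (simp add: powr_diff)
  ultimately have "((\<lambda>r::real. r powr s / r) \<longlongrightarrow> 0) (at_right 0)"
    using tendsto_cong by fast
  moreover have "at (0::real) within {0..} = at_right 0"
    by (simp add: at_within_Ici_at_right)
  ultimately show ?thesis
    using assms by (simp add: has_field_derivative_iff)
qed

text \<open>At the origin the base is \<open>(N - 2) * (N + \<sigma>) / C\<close>, a positive
  number. Finiteness of the value is implicit in its being real.\<close>

lemma U_profile_at_0:
  assumes "N \<ge> 3" "\<sigma> > -2" "C > 0"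
  shows "U_profile N m \<sigma> C 0 > 0"
  using assms by (simp add: U_profile_def)

text \<open>The bound on \<open>\<sigma>\<close> makes the inner exponent
  \<open>\<sigma> + 2\<close> exceed 1, so the inner function has slope 0 at the origin. The outer
  power is differentiable there because its argument is \<open>C > 0\<close>.\<close>

lemma U_profile_has_derivative_0:
  assumes "\<sigma> > -1" "C > 0"
  shows "(U_profile N m \<sigma> C has_real_derivative 0) (at 0 within {0..})"
proof -
  define K where "K = ((real N - 2) * (real N + \<sigma>) * C) powr ((real N - 2) / (2 * m * (\<sigma> + 2)))"
  define b where "b = - ((real N - 2) / (m * (\<sigma> + 2)))"
  have "((\<lambda>r. r powr (\<sigma> + 2) + C) has_real_derivative 0) (at 0 within {0..})"
    using DERIV_add[OF powr_has_derivative_0_at_0 DERIV_const] assms by simp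
  moreover have "((\<lambda>y. y powr b) has_real_derivative b * C powr (b - 1)) (at (0 powr (\<sigma> + 2) + C))"
    using has_real_derivative_powr[OF \<open>C > 0\<close>] by simp
  ultimately have "((\<lambda>r. (r powr (\<sigma> + 2) + C) powr b) has_real_derivative
      b * C powr (b - 1) * 0) (at 0 within {0..})"
    by (rule DERIV_chain2[rotated])
  from DERIV_cmult[OF this, of K] show ?thesis
    by (simp add: U_profile_eq[OF \<open>C > 0\<close>, abs_def] K_def b_def)
qed

text \<open>The constant \<open>C\<close> is negligible against
  \<open>r powr (\<sigma> + 2)\<close>, and raising to a fixed power preserves asymptotic
  equivalence. The witness is the constant factor of the profile.\<close>

lemma U_profile_asymp_equiv:
  assumes "N \<ge> 3" "m > 0" "\<sigma> > -2" "C > 0"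
  shows "\<exists>K>0. U_profile N m \<sigma> C \<sim>[at_top] (\<lambda>r. K * r powr (- (real N - 2) / m))"
proof -
  define K where "K = ((real N - 2) * (real N + \<sigma>) * C) powr ((real N - 2) / (2 * m * (\<sigma> + 2)))"
  define b where "b = - ((real N - 2) / (m * (\<sigma> + 2)))"
  define s where "s = \<sigma> + 2"
  have s: "s > 0" and K: "K > 0" using assms by (simp_all add: s_def K_def)
  have e: "- (real N - 2) / m = s * b" using s by (simp add: b_def divide_simps flip: s_def)
  have "(\<lambda>r. r powr s + C) \<sim>[at_top] (\<lambda>r. r powr s)"
    using s by real_asymp
  then have "(\<lambda>r. (r powr s + C) powr b) \<sim>[at_top] (\<lambda>r. (r powr s) powr b)"
    using \<open>C > 0\<close> by (intro asymp_equiv_powr_real) (auto intro!: always_eventually add_nonneg_nonneg)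
  then have "(\<lambda>r. K * (r powr s + C) powr b) \<sim>[at_top] (\<lambda>r. K * r powr (s * b))"
    by (simp add: powr_powr asymp_equiv_intros)
  then have "U_profile N m \<sigma> C \<sim>[at_top] (\<lambda>r. K * r powr (- (real N - 2) / m))"
    unfolding e by (simp add: U_profile_eq[OF \<open>C > 0\<close>, abs_def] K_def b_def s_def)
  with K show ?thesis by blast
qed

theorem mainTheorem3:
  fixes N :: nat and m \<sigma> p C :: real
  assumes "CARD('n::finite) = N" and "N \<ge> 3"
    and "m > 0" and "\<sigma> > -2" and "p = p_s N m \<sigma>" and "C > 0"
  shows "stationary_solution m \<sigma> p (U_C m \<sigma> C :: real ^ 'n \<Rightarrow> real) \<and>
         (\<forall>x :: real ^ 'n. x \<noteq> 0 \<longrightarrow>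
           laplacian (\<lambda>y. U_C m \<sigma> C y powr m) x + norm x powr \<sigma> * U_C m \<sigma> C x powr p = 0) \<and>
         (m < 1 \<and> \<sigma> > 0 \<longrightarrow>
           U_profile N m \<sigma> C 0 > 0 \<and>
           (U_profile N m \<sigma> C has_real_derivative 0) (at 0 within {0..}) \<and>
           (\<exists>K>0. U_profile N m \<sigma> C \<sim>[at_top] (\<lambda>r. K * r powr (- (real N - 2) / m))))"
proof (intro conjI impI)
  show "stationary_solution m \<sigma> p (U_C m \<sigma> C :: real ^ 'n \<Rightarrow> real)"
    and "\<forall>x :: real ^ 'n. x \<noteq> 0 \<longrightarrow>
      laplacian (\<lambda>y. U_C m \<sigma> C y powr m) x + norm x powr \<sigma> * U_C m \<sigma> C x powr p = 0"
    \<comment> \<open>The solution is constant in time, so its time derivative is 0 and the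
      evolution equation reduces to the elliptic one.\<close>
    using U_C_elliptic[where ?'n = 'n, of m \<sigma> C] assms
    by (auto simp: stationary_solution_def satisfies_pde_at_def)
  show "U_profile N m \<sigma> C 0 > 0"
    using assms by (intro U_profile_at_0)
  show "\<exists>K>0. U_profile N m \<sigma> C \<sim>[at_top] (\<lambda>r. K * r powr (- (real N - 2) / m))"
    using assms by (intro U_profile_asymp_equiv)
  assume "m < 1 \<and> \<sigma> > 0"
  then show "(U_profile N m \<sigma> C has_real_derivative 0) (at 0 within {0..})"
    using assms by (intro U_profile_has_derivative_0) auto
qed

end
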